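(* Let $(A,[-,-]_A,\delta,P,Q)$ be an averaging Lie bialgebra. Then there is a special type-$a$ pre-Leibniz bialgebra $(A,\succ_A,\prec_A,\vartheta,\theta)$, where $$x\succ_A y=[P(x),y]_A-Q([x,y]_A),\qquad x\prec_A y=Q([x,y]_A),\qquad\forall x,y\in A,$$ $$\vartheta(x)=(Q\otimes\mathrm{id})\delta(x)-\delta(P(x)),\qquad \theta(x)=\delta(P(x)),\qquad\forall x\in A.$$
   Context: All vector spaces are finite-dimensional over an algebraically closed field $\mathbb{K}$ of characteristic zero. $\tau(x\otimes y)=y\otimes x$. For a multiplication $\ast$ on $A$, $L_\ast(x)y=x\ast y$ and $R_\ast(x)y=y\ast x$. A Lie bialgebra $(A,[-,-]_A,\delta)$: $(A,[-,-]_A)$ is a Lie algebra; $(A,\delta)$ is a Lie coalgebra, i.e. $\delta:A\to A\otimes A$ is linear with $\delta=-\tau\delta$ and $(\mathrm{id}+\sigma+\sigma^2)(\mathrm{id}\otimes\delta)\delta=0$, where $\sigma(x\otimes y\otimes z)=z\otimes x\otimes y$; and $\delta([x,y]_A)=(\mathrm{ad}_A(x)\otimes\mathrm{id}+\mathrm{id}\otimes\mathrm{ad}_A(x))\delta(y)-(\mathrm{ad}_A(y)\otimes\mathrm{id}+\mathrm{id}\otimes\mathrm{ad}_A(y))\delta(x)$ for all $x,y\in A$. An averaging Lie bialgebra $(A,[-,-]_A,\delta,P,Q)$: a Lie bialgebra $(A,[-,-]_A,\delta)$ with linear maps $P,Q:A\to A$ such that for all $x,y\in A$: (i) $[P(x),P(y)]_A=P([P(x),y]_A)$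 and $[P(x),Q(y)]_A=Q([P(x),y]_A)=Q([x,Q(y)]_A)$; (ii) $(Q\otimes Q)\delta(x)=(Q\otimes\mathrm{id})\delta(Q(x))$ and $(Q\otimes P)\delta(x)=(Q\otimes\mathrm{id})\delta(P(x))=(\mathrm{id}\otimes P)\delta(P(x))$. A Leibniz algebra: a bilinear multiplication with $x\circ_A(y\circ_A z)=(x\circ_A y)\circ_A z+y\circ_A(x\circ_A z)$. A special type-$a$ pre-Leibniz algebra (with $a=\begin{pmatrix}1&-1\\-1&0\end{pmatrix}$): a vector space $A$ with bilinear multiplications $\succ_A,\prec_A$ such that $\prec_A$ is anticommutative, $(A,\circ_A)$ with $x\circ_A y:=x\succ_A y+x\prec_A y$ is a Leibniz algebra, and $x\circ_A(y\prec_A z)=(x\circ_A y)\prec_A z+y\prec_A(x\circ_A z)=x\prec_A(y\prec_A z)$ for all $x,y,z\in A$. A special type-$a$ pre-Leibniz coalgebra $(A,\vartheta,\theta)$: linear maps $\vartheta,\theta:A\to A\otimes A$ such that, with $\eta=\vartheta+\theta$, for all $x\in A$: $(\eta\otimes\mathrm{id})\eta(x)+(\tau\otimes\mathrm{id})(\mathrm{id}\otimes\eta)\eta(x)-(\mathrm{id}\otimes\eta)\eta(x)=0$; $\theta(x)=-\tau\theta(x)$; $(\mathrm{id}\otimes\theta)\eta(x)=(\eta\otimes\mathrm{id})\theta(x)+(\tau\otimes\mathrm{id})(\mathrm{id}\otimes\eta)\theta(x)$; $(\mathrm{id}\otimes\theta)\vartheta(x)=0$. A special type-$a$ pre-Leibniz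 bialgebra $(A,\succ_A,\prec_A,\vartheta,\theta)$: $(A,\succ_A,\prec_A)$ is a special type-$a$ pre-Leibniz algebra, $(A,\vartheta,\theta)$ is a special type-$a$ pre-Leibniz coalgebra, and for all $x,y\in A$ (with $\circ_A=\succ_A+\prec_A$, $\eta=\vartheta+\theta$): $$\eta(x\prec_A y)=(\mathrm{id}\otimes\mathrm{id}-\tau)\big(\mathrm{id}\otimes L_{\prec_A}(x)\big)\eta(y)+(\mathrm{id}\otimes\mathrm{id}-\tau)\big(\mathrm{id}\otimes R_{\prec_A}(y)\big)\eta(x),$$ $$\big(L_{\circ_A}(x)\otimes\mathrm{id}\big)\eta(y)=\big(L_{\prec_A}(x)\otimes\mathrm{id}\big)\eta(y)+\big(\mathrm{id}\otimes R_{\circ_A}(y)\big)\eta(x)-\big(\mathrm{id}\otimes R_{\circ_A}(y)\big)\theta(x),$$ $$\theta(x\circ_A y)=\big(\mathrm{id}\otimes L_{\circ_A}(x)+L_{\circ_A}(x)\otimes\mathrm{id}\big)\theta(y)-\big(\mathrm{id}\otimes L_{\circ_A}(y)+L_{\circ_A}(y)\otimes\mathrm{id}\big)\theta(x),$$ $$\eta(x\circ_A y)=\big(\mathrm{id}\otimes R_{\circ_A}(y)\big)\eta(x)+\big(\mathrm{id}\otimes L_{\circ_A}(x)+L_{\prec_A}(x)\otimes\mathrm{id}\big)\eta(y)-\big(L_{\prec_A}(y)\otimes\mathrm{id}\big)\theta(x).$$ *)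

theory Defs
  imports
    Complex_Main
    "HOL-Library.Function_Algebras"
    "HOL-Computational_Algebra.Polynomial"
begin

section \<open>Tensor squares and tensor cubes\<close>

text \<open>
  A vector space is a type of class \<^class>\<open>ab_group_add\<close> with an explicit scalar multiplication
  \<open>s\<close>, as in \<^locale>\<open>vector_space\<close>. The tensor product of \<open>A\<close> with itself is realised inside
  the space of bilinear forms on the dual space: the pure tensor of \<open>x\<close> and \<open>y\<close> sends
  \<open>(\<phi>, \<psi>)\<close> to \<open>\<phi> x * \<psi> y\<close>, and the tensor square is the linear span of the pure tensors.
  HOL functions are total, so tensors are by convention \<open>0\<close> as soon as an argument is not a
  linear form; thus tensors agreeing on linear forms are equal. Addition, subtraction and \<open>0\<close>
  of tensors, and of maps between tensor spaces, are pointwise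
  (\<^theory>\<open>HOL-Library.Function_Algebras\<close>). The theorems \<open>tensor2_universal\<close>,
  \<open>tensor2_unique\<close>, \<open>tensor3_universal\<close> and \<open>tensor3_unique\<close> below are the universal
  properties.
\<close>

definition dual_space :: "('k::field \<Rightarrow> 'a::ab_group_add \<Rightarrow> 'a) \<Rightarrow> ('a \<Rightarrow> 'k) set" where
  "dual_space s = {\<phi>. Vector_Spaces.linear s (*) \<phi>}"

type_synonym ('a, 'k) tensor2 = "('a \<Rightarrow> 'k) \<Rightarrow> ('a \<Rightarrow> 'k) \<Rightarrow> 'k"
type_synonym ('a, 'k) tensor3 = "('a \<Rightarrow> 'k) \<Rightarrow> ('a \<Rightarrow> 'k) \<Rightarrow> ('a \<Rightarrow> 'k) \<Rightarrow> 'k"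

definition scale2 :: "'k::field \<Rightarrow> ('a, 'k) tensor2 \<Rightarrow> ('a, 'k) tensor2" where
  "scale2 c t = (\<lambda>\<phi> \<psi>. c * t \<phi> \<psi>)"

definition scale3 :: "'k::field \<Rightarrow> ('a, 'k) tensor3 \<Rightarrow> ('a, 'k) tensor3" where
  "scale3 c t = (\<lambda>\<phi> \<psi> \<chi>. c * t \<phi> \<psi> \<chi>)"

definition pure2 :: "('k::field \<Rightarrow> 'a::ab_group_add \<Rightarrow> 'a) \<Rightarrow> 'a \<Rightarrow> 'a \<Rightarrow> ('a, 'k) tensor2" where
  "pure2 s x y = (\<lambda>\<phi> \<psi>. if \<phi> \<in> dual_space s \<and> \<psi> \<in> dual_space s then \<phi> x * \<psi> y else 0)"

definition pure3 :: "('k::field \<Rightarrow> 'a::ab_group_add \<Rightarrow> 'a) \<Rightarrow> 'a \<Rightarrow> 'a \<Rightarrow> 'a \<Rightarrow> ('a, 'k) tensor3" where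
  "pure3 s x y z = (\<lambda>\<phi> \<psi> \<chi>.
     if \<phi> \<in> dual_space s \<and> \<psi> \<in> dual_space s \<and> \<chi> \<in> dual_space s then \<phi> x * \<psi> y * \<chi> z else 0)"

definition tensor2_space :: "('k::field \<Rightarrow> 'a::ab_group_add \<Rightarrow> 'a) \<Rightarrow> ('a, 'k) tensor2 set" where
  "tensor2_space s = module.span scale2 {pure2 s x y |x y. True}"

definition tensor3_space :: "('k::field \<Rightarrow> 'a::ab_group_add \<Rightarrow> 'a) \<Rightarrow> ('a, 'k) tensor3 set" where
  "tensor3_space s = module.span scale3 {pure3 s x y z |x y z. True}"

text \<open>
  The maps between tensor spaces, by precomposition with the transposed maps:
  \<open>tmap s f g\<close> is \<open>f \<otimes> g\<close>, \<open>tau\<close> is the flip \<open>\<tau>\<close>, \<open>id_tensor D\<close> and \<open>tensor_id D\<close> are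
  \<open>id \<otimes> D\<close> and \<open>D \<otimes> id\<close> for a map \<open>D\<close> into the tensor square, \<open>tau_id\<close> is \<open>\<tau> \<otimes> id\<close> and
  \<open>sigma\<close> is the cyclic shift sending \<open>x \<otimes> y \<otimes> z\<close> to \<open>z \<otimes> x \<otimes> y\<close>. Their values on
  pure tensors are computed in the lemmas below.
\<close>

definition tmap :: "('k::field \<Rightarrow> 'a::ab_group_add \<Rightarrow> 'a) \<Rightarrow> ('a \<Rightarrow> 'a) \<Rightarrow> ('a \<Rightarrow> 'a)
    \<Rightarrow> ('a, 'k) tensor2 \<Rightarrow> ('a, 'k) tensor2" where
  "tmap s f g t = (\<lambda>\<phi> \<psi>.
     if \<phi> \<in> dual_space s \<and> \<psi> \<in> dual_space s then t (\<phi> \<circ> f) (\<psi> \<circ> g) else 0)"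

definition tau :: "('a, 'k) tensor2 \<Rightarrow> ('a, 'k) tensor2" where
  "tau t = (\<lambda>\<phi> \<psi>. t \<psi> \<phi>)"

definition id_tensor :: "('a \<Rightarrow> ('a, 'k) tensor2) \<Rightarrow> ('a, 'k) tensor2 \<Rightarrow> ('a, 'k) tensor3" where
  "id_tensor D t = (\<lambda>\<phi> \<psi> \<chi>. t \<phi> (\<lambda>y. D y \<psi> \<chi>))"

definition tensor_id :: "('a \<Rightarrow> ('a, 'k) tensor2) \<Rightarrow> ('a, 'k) tensor2 \<Rightarrow> ('a, 'k) tensor3" where
  "tensor_id D t = (\<lambda>\<phi> \<psi> \<chi>. t (\<lambda>x. D x \<phi> \<psi>) \<chi>)"

definition tau_id :: "('a, 'k) tensor3 \<Rightarrow> ('a, 'k) tensor3" where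
  "tau_id t = (\<lambda>\<phi> \<psi> \<chi>. t \<psi> \<phi> \<chi>)"

definition sigma :: "('a, 'k) tensor3 \<Rightarrow> ('a, 'k) tensor3" where
  "sigma t = (\<lambda>\<phi> \<psi> \<chi>. t \<psi> \<chi> \<phi>)"

definition linear_coproduct ::
  "('k::field \<Rightarrow> 'a::ab_group_add \<Rightarrow> 'a) \<Rightarrow> ('a \<Rightarrow> ('a, 'k) tensor2) \<Rightarrow> bool" where
  "linear_coproduct s D \<longleftrightarrow> Vector_Spaces.linear s scale2 D \<and> (\<forall>x. D x \<in> tensor2_space s)"


subsection \<open>Adequacy of the realisation\<close>

lemma vector_space_field: "vector_space ((*) :: 'k::field \<Rightarrow> 'k \<Rightarrow> 'k)"
  by unfold_locales (auto simp: algebra_simps)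

lemma vector_space_scale2: "vector_space (scale2 :: 'k::field \<Rightarrow> ('a, 'k) tensor2 \<Rightarrow> _)"
  by unfold_locales (auto simp: scale2_def fun_eq_iff algebra_simps)

lemma vector_space_scale3: "vector_space (scale3 :: 'k::field \<Rightarrow> ('a, 'k) tensor3 \<Rightarrow> _)"
  by unfold_locales (auto simp: scale3_def fun_eq_iff algebra_simps)

lemma linearI:
  assumes "vector_space s1" "vector_space s2"
    and "\<And>x y. f (x + y) = f x + f y" "\<And>c x. f (s1 c x) = s2 c (f x)"
  shows "Vector_Spaces.linear s1 s2 f"
  using assms by (simp add: Vector_Spaces.linear_iff)

lemma dual_comp:
  "\<lbrakk>Vector_Spaces.linear s s f; \<phi> \<in> dual_space s\<rbrakk> \<Longrightarrow> \<phi> \<circ> f \<in> dual_space s"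
  unfolding dual_space_def by (auto intro: Vector_Spaces.linear_compose)

lemma dual_add: "\<phi> \<in> dual_space s \<Longrightarrow> \<phi> (x + y) = \<phi> x + \<phi> y"
  and dual_scale: "\<phi> \<in> dual_space s \<Longrightarrow> \<phi> (s c x) = c * \<phi> x"
  by (simp_all add: dual_space_def Vector_Spaces.linear_iff)

lemma linear_pure2:
  assumes "vector_space s"
  shows "Vector_Spaces.linear s scale2 (pure2 s x)"
    and "Vector_Spaces.linear s scale2 (\<lambda>x. pure2 s x y)"
  by (auto intro!: linearI assms vector_space_scale2
      simp: pure2_def scale2_def fun_eq_iff dual_add dual_scale algebra_simps)

lemma linear_pure3:
  assumes "vector_space s"
  shows "Vector_Spaces.linear s scale3 (pure3 s x y)"
    and "Vector_Spaces.linear s scale3 (\<lambda>y. pure3 s x y z)"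
    and "Vector_Spaces.linear s scale3 (\<lambda>x. pure3 s x y z)"
  by (auto intro!: linearI assms vector_space_scale3
      simp: pure3_def scale3_def fun_eq_iff dual_add dual_scale algebra_simps)

lemma tmap_pure2:
  assumes "Vector_Spaces.linear s s f" "Vector_Spaces.linear s s g"
  shows "tmap s f g (pure2 s x y) = pure2 s (f x) (g y)"
  using dual_comp[OF assms(1)] dual_comp[OF assms(2)]
  by (auto simp: tmap_def pure2_def fun_eq_iff)

lemma tau_pure2: "tau (pure2 s x y) = pure2 s y x"
  by (auto simp: tau_def pure2_def fun_eq_iff)

lemma tau_id_pure3: "tau_id (pure3 s x y z) = pure3 s y x z"
  by (auto simp: tau_id_def pure3_def fun_eq_iff)

lemma sigma_pure3: "sigma (pure3 s x y z) = pure3 s z x y"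
  by (auto simp: sigma_def pure3_def fun_eq_iff)

lemma sum_fun_apply: "sum f I x = (\<Sum>i\<in>I. f i x)"
  by (induction I rule: infinite_finite_induct) auto

lemma dual_coproduct:
  assumes "Vector_Spaces.linear s scale2 D"
  shows "(\<lambda>y. D y \<psi> \<chi>) \<in> dual_space s"
  using assms
  by (auto simp: dual_space_def Vector_Spaces.linear_iff scale2_def vector_space_field)

lemma id_tensor_pure2:
  assumes "Vector_Spaces.linear s scale2 D"
    and "D y = (\<Sum>i\<in>I. pure2 s (a i) (b i))"
  shows "id_tensor D (pure2 s x y) = (\<Sum>i\<in>I. pure3 s x (a i) (b i))"
  using dual_coproduct[OF assms(1)]
  by (auto simp: id_tensor_def pure2_def pure3_def fun_eq_iff assms(2) sum_fun_apply
      sum_distrib_left mult.assoc intro!: sum.cong)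

lemma tensor_id_pure2:
  assumes "Vector_Spaces.linear s scale2 D"
    and "D x = (\<Sum>i\<in>I. pure2 s (a i) (b i))"
  shows "tensor_id D (pure2 s x y) = (\<Sum>i\<in>I. pure3 s (a i) (b i) y)"
  using dual_coproduct[OF assms(1)]
  by (auto simp: tensor_id_def pure2_def pure3_def fun_eq_iff assms(2) sum_fun_apply
      sum_distrib_right intro!: sum.cong)

lemma tensor_maps_linear:
  "Vector_Spaces.linear scale2 scale2 (tmap s f g)"
  "Vector_Spaces.linear scale2 scale2 (tau :: ('a, 'k::field) tensor2 \<Rightarrow> _)"
  "Vector_Spaces.linear scale2 scale3 (id_tensor (D :: 'a \<Rightarrow> ('a, 'k) tensor2))"
  "Vector_Spaces.linear scale2 scale3 (tensor_id D)"
  "Vector_Spaces.linear scale3 scale3 (tau_id :: ('a, 'k) tensor3 \<Rightarrow> _)"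
  "Vector_Spaces.linear scale3 scale3 (sigma :: ('a, 'k) tensor3 \<Rightarrow> _)"
  by (auto intro!: linearI vector_space_scale2 vector_space_scale3
      simp: tmap_def tau_def id_tensor_def tensor_id_def tau_id_def sigma_def
        scale2_def scale3_def fun_eq_iff)

lemma dual_basis:
  assumes "vector_space s" "\<not> module.dependent s B" "b \<in> B"
  obtains \<phi> where "\<phi> \<in> dual_space s" "\<And>b'. b' \<in> B \<Longrightarrow> \<phi> b' = (if b' = b then 1 else 0)"
proof -
  interpret vector_space_pair s "(*)"
    using assms(1) vector_space_field by (simp add: vector_space_pair_def)
  show ?thesis
    by (rule that[of "construct B (\<lambda>b'. if b' = b then 1 else 0)"])
      (use assms(2) in \<open>auto simp: dual_space_def linear_construct construct_basis\<close>)
qed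

lemma linear_eqI:
  assumes "Vector_Spaces.linear s1 s2 f" "Vector_Spaces.linear s1 s2 g"
    "module.span s1 B = UNIV" "\<And>b. b \<in> B \<Longrightarrow> f b = g b"
  shows "f x = g x"
proof -
  interpret vector_space_pair s1 s2
    using assms(1) by (simp add: Vector_Spaces.linear_def vector_space_pair_def)
  show ?thesis using linear_eq_on[OF assms(1,2), of x B] assms(3,4) by auto
qed

lemma basis_exists':
  assumes "vector_space s"
  obtains B where "\<not> module.dependent s B" "module.span s B = UNIV"
proof -
  interpret vector_space s by fact
  show ?thesis
    by (rule that[of "extend_basis {}"]) (simp_all add: independent_extend_basis span_extend_basis independent_empty)
qed

lemma construct_exists:
  assumes "vector_space s1" "vector_space s2" "\<not> module.dependent s1 B"
  shows "\<exists>h. Vector_Spaces.linear s1 s2 h \<and> (\<forall>b\<in>B. h b = g b)"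
proof -
  interpret vector_space_pair s1 s2
    using assms(1,2) by (simp add: vector_space_pair_def)
  show ?thesis
    by (rule exI[of _ "construct B g"])
      (use assms(3) in \<open>auto simp: linear_construct construct_basis\<close>)
qed

lemma independent_dualI:
  assumes "vector_space s"
    and "\<And>i. i \<in> I \<Longrightarrow> \<exists>\<Phi>. Vector_Spaces.linear s (*) \<Phi> \<and> (\<forall>j\<in>I. \<Phi> (v j) = (if j = i then 1 else 0))"
  shows "inj_on v I" "\<not> module.dependent s (v ` I)"
proof -
  interpret vector_space s by fact
  show inj: "inj_on v I"
  proof (rule inj_onI)
    fix i j assume "i \<in> I" "j \<in> I" "v i = v j"
    with assms(2)[of i] show "i = j" by (metis zero_neq_one)
  qed
  show "independent (v ` I)"
    unfolding independent_explicit_module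
  proof (intro allI impI)
    fix T u w
    assume "finite T" and "T \<subseteq> v ` I" and sum0: "(\<Sum>x\<in>T. s (u x) x) = 0" and "w \<in> T"
    then obtain i where i: "i \<in> I" "w = v i" by auto
    obtain \<Phi> where \<Phi>: "Vector_Spaces.linear s (*) \<Phi>" "\<forall>j\<in>I. \<Phi> (v j) = (if j = i then 1 else 0)"
      using assms(2)[OF i(1)] by blast
    interpret \<Phi>: Vector_Spaces.linear s "(*)" \<Phi> by fact
    have "0 = \<Phi> (\<Sum>x\<in>T. s (u x) x)" by (simp add: sum0)
    also have "\<dots> = (\<Sum>x\<in>T. u x * \<Phi> x)" by (simp add: \<Phi>.sum \<Phi>.scale)
    also have "\<dots> = (\<Sum>x\<in>T. if x = w then u x else 0)"
    proof (rule sum.cong[OF refl])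
      fix x assume "x \<in> T"
      then obtain j where "j \<in> I" "x = v j" using \<open>T \<subseteq> v ` I\<close> by auto
      then show "u x * \<Phi> x = (if x = w then u x else 0)"
        using \<Phi>(2) i inj by (auto simp: inj_on_def)
    qed
    also have "\<dots> = u w" using \<open>finite T\<close> \<open>w \<in> T\<close> by simp
    finally show "u w = 0" by simp
  qed
qed

theorem tensor2_universal:
  fixes s :: "'k::field \<Rightarrow> 'a::ab_group_add \<Rightarrow> 'a" and s' :: "'k \<Rightarrow> 'b::ab_group_add \<Rightarrow> 'b"
  assumes s: "vector_space s" and s': "vector_space s'"
    and lin: "\<And>x. Vector_Spaces.linear s s' (\<beta> x)" "\<And>y. Vector_Spaces.linear s s' (\<lambda>x. \<beta> x y)"
  shows "\<exists>h. Vector_Spaces.linear scale2 s' h \<and> (\<forall>x y. h (pure2 s x y) = \<beta> x y)"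
proof -
  obtain B where B: "\<not> module.dependent s B" "module.span s B = UNIV"
    using basis_exists'[OF s] .
  have "\<exists>\<Phi>. Vector_Spaces.linear scale2 (*) \<Phi> \<and>
      (\<forall>j\<in>B \<times> B. \<Phi> ((\<lambda>(x, y). pure2 s x y) j) = (if j = i then 1 else 0))"
    if iB: "i \<in> B \<times> B" for i
  proof -
    obtain x y where i: "i = (x, y)" "x \<in> B" "y \<in> B" using iB by auto
    obtain \<phi> where "\<phi> \<in> dual_space s" "\<And>b'. b' \<in> B \<Longrightarrow> \<phi> b' = (if b' = x then 1 else 0)"
      using dual_basis[OF s B(1) i(2)] by metis
    moreover obtain \<psi> where "\<psi> \<in> dual_space s" "\<And>b'. b' \<in> B \<Longrightarrow> \<psi> b' = (if b' = y then 1 else 0)"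
      using dual_basis[OF s B(1) i(3)] by metis
    ultimately show ?thesis
      by (intro exI[of _ "\<lambda>t. t \<phi> \<psi>"] conjI linearI vector_space_scale2 vector_space_field)
        (auto simp: pure2_def scale2_def i(1))
  qed
  note ex = this
  have ind: "inj_on (\<lambda>(x, y). pure2 s x y) (B \<times> B)"
    "\<not> module.dependent scale2 ((\<lambda>(x, y). pure2 s x y) ` (B \<times> B))"
    by (rule independent_dualI[OF vector_space_scale2 ex]; assumption)+
  have "\<exists>h. Vector_Spaces.linear scale2 s' h \<and>
      (\<forall>t\<in>(\<lambda>(x, y). pure2 s x y) ` (B \<times> B).
      h t = (\<lambda>(x, y). \<beta> x y) (inv_into (B \<times> B) (\<lambda>(x, y). pure2 s x y) t))"
    by (rule construct_exists[OF vector_space_scale2 s' ind(2)])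
  then obtain h where h: "Vector_Spaces.linear scale2 s' h"
    and hb: "\<forall>t\<in>(\<lambda>(x, y). pure2 s x y) ` (B \<times> B).
      h t = (\<lambda>(x, y). \<beta> x y) (inv_into (B \<times> B) (\<lambda>(x, y). pure2 s x y) t)"
    by (elim exE conjE)
  have hB: "h (pure2 s x y) = \<beta> x y" if "x \<in> B" "y \<in> B" for x y
    using bspec[OF hb imageI[of "(x, y)"]] inv_into_f_f[OF ind(1), of "(x, y)"] that by simp
  have l: "Vector_Spaces.linear s s' (\<lambda>y. h (pure2 s x y))"
    "Vector_Spaces.linear s s' (\<lambda>x. h (pure2 s x y))" for x y
    using Vector_Spaces.linear_compose[OF linear_pure2(1)[OF s] h]
      Vector_Spaces.linear_compose[OF linear_pure2(2)[OF s] h] by (auto simp: o_def)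
  have h1: "h (pure2 s x y) = \<beta> x y" if "x \<in> B" for x y
    using linear_eqI[OF l(1)[of x] lin(1)[of x] B(2) hB[OF that]] .
  have h2: "h (pure2 s x y) = \<beta> x y" for x y
    using linear_eqI[OF l(2)[of y] lin(2)[of y] B(2) h1] .
  show "\<exists>h. Vector_Spaces.linear scale2 s' h \<and> (\<forall>x y. h (pure2 s x y) = \<beta> x y)"
    by (rule exI[of _ h], rule conjI, rule h, intro allI, rule h2)
qed

theorem tensor2_unique:
  fixes s :: "'k::field \<Rightarrow> 'a::ab_group_add \<Rightarrow> 'a" and s' :: "'k \<Rightarrow> 'b::ab_group_add \<Rightarrow> 'b"
  assumes h: "Vector_Spaces.linear scale2 s' h" and h': "Vector_Spaces.linear scale2 s' h'"
    and eq: "\<And>x y. h (pure2 s x y) = h' (pure2 s x y)" and t: "t \<in> tensor2_space s"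
  shows "h t = h' t"
proof -
  interpret vector_space_pair "scale2 :: 'k \<Rightarrow> ('a, 'k) tensor2 \<Rightarrow> _" s'
    using h by (simp add: Vector_Spaces.linear_def vector_space_pair_def)
  show "h t = h' t"
    by (rule linear_eq_on[OF h h' t[unfolded tensor2_space_def]]) (auto simp: eq)
qed

theorem tensor3_universal:
  fixes s :: "'k::field \<Rightarrow> 'a::ab_group_add \<Rightarrow> 'a" and s' :: "'k \<Rightarrow> 'b::ab_group_add \<Rightarrow> 'b"
  assumes s: "vector_space s" and s': "vector_space s'"
    and lin: "\<And>x y. Vector_Spaces.linear s s' (\<beta> x y)"
      "\<And>x z. Vector_Spaces.linear s s' (\<lambda>y. \<beta> x y z)"
      "\<And>y z. Vector_Spaces.linear s s' (\<lambda>x. \<beta> x y z)"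
  shows "\<exists>h. Vector_Spaces.linear scale3 s' h \<and> (\<forall>x y z. h (pure3 s x y z) = \<beta> x y z)"
proof -
  obtain B where B: "\<not> module.dependent s B" "module.span s B = UNIV"
    using basis_exists'[OF s] .
  have "\<exists>\<Phi>. Vector_Spaces.linear scale3 (*) \<Phi> \<and>
      (\<forall>j\<in>B \<times> B \<times> B. \<Phi> ((\<lambda>(x, y, z). pure3 s x y z) j) = (if j = i then 1 else 0))"
    if iB: "i \<in> B \<times> B \<times> B" for i
  proof -
    obtain x y z where i: "i = (x, y, z)" "x \<in> B" "y \<in> B" "z \<in> B" using iB by auto
    obtain \<phi> where "\<phi> \<in> dual_space s" "\<And>b'. b' \<in> B \<Longrightarrow> \<phi> b' = (if b' = x then 1 else 0)"
      using dual_basis[OF s B(1) i(2)] by metis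
    moreover obtain \<psi> where "\<psi> \<in> dual_space s" "\<And>b'. b' \<in> B \<Longrightarrow> \<psi> b' = (if b' = y then 1 else 0)"
      using dual_basis[OF s B(1) i(3)] by metis
    moreover obtain \<chi> where "\<chi> \<in> dual_space s" "\<And>b'. b' \<in> B \<Longrightarrow> \<chi> b' = (if b' = z then 1 else 0)"
      using dual_basis[OF s B(1) i(4)] by metis
    ultimately show ?thesis
      by (intro exI[of _ "\<lambda>t. t \<phi> \<psi> \<chi>"] conjI linearI vector_space_scale3 vector_space_field)
        (auto simp: pure3_def scale3_def i(1))
  qed
  note ex = this
  have ind: "inj_on (\<lambda>(x, y, z). pure3 s x y z) (B \<times> B \<times> B)"
    "\<not> module.dependent scale3 ((\<lambda>(x, y, z). pure3 s x y z) ` (B \<times> B \<times> B))"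
    by (rule independent_dualI[OF vector_space_scale3 ex]; assumption)+
  have "\<exists>h. Vector_Spaces.linear scale3 s' h \<and>
      (\<forall>t\<in>(\<lambda>(x, y, z). pure3 s x y z) ` (B \<times> B \<times> B).
      h t = (\<lambda>(x, y, z). \<beta> x y z) (inv_into (B \<times> B \<times> B) (\<lambda>(x, y, z). pure3 s x y z) t))"
    by (rule construct_exists[OF vector_space_scale3 s' ind(2)])
  then obtain h where h: "Vector_Spaces.linear scale3 s' h"
    and hb: "\<forall>t\<in>(\<lambda>(x, y, z). pure3 s x y z) ` (B \<times> B \<times> B).
      h t = (\<lambda>(x, y, z). \<beta> x y z) (inv_into (B \<times> B \<times> B) (\<lambda>(x, y, z). pure3 s x y z) t)"
    by (elim exE conjE)
  have hB: "h (pure3 s x y z) = \<beta> x y z" if "x \<in> B" "y \<in> B" "z \<in> B" for x y z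
    using bspec[OF hb imageI[of "(x, y, z)"]] inv_into_f_f[OF ind(1), of "(x, y, z)"] that by simp
  have l: "Vector_Spaces.linear s s' (\<lambda>z. h (pure3 s x y z))"
    "Vector_Spaces.linear s s' (\<lambda>y. h (pure3 s x y z))"
    "Vector_Spaces.linear s s' (\<lambda>x. h (pure3 s x y z))" for x y z
    using Vector_Spaces.linear_compose[OF linear_pure3(1)[OF s] h]
      Vector_Spaces.linear_compose[OF linear_pure3(2)[OF s] h]
      Vector_Spaces.linear_compose[OF linear_pure3(3)[OF s] h] by (auto simp: o_def)
  have h1: "h (pure3 s x y z) = \<beta> x y z" if "x \<in> B" "y \<in> B" for x y z
    using linear_eqI[OF l(1)[of x y] lin(1)[of x y] B(2) hB[OF that]] .
  have h2: "h (pure3 s x y z) = \<beta> x y z" if "x \<in> B" for x y z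
    using linear_eqI[OF l(2)[of x z] lin(2)[of x z] B(2) h1[OF that]] .
  have h3: "h (pure3 s x y z) = \<beta> x y z" for x y z
    using linear_eqI[OF l(3)[of y z] lin(3)[of y z] B(2) h2] .
  show "\<exists>h. Vector_Spaces.linear scale3 s' h \<and> (\<forall>x y z. h (pure3 s x y z) = \<beta> x y z)"
    by (rule exI[of _ h], rule conjI, rule h, intro allI, rule h3)
qed

theorem tensor3_unique:
  fixes s :: "'k::field \<Rightarrow> 'a::ab_group_add \<Rightarrow> 'a" and s' :: "'k \<Rightarrow> 'b::ab_group_add \<Rightarrow> 'b"
  assumes h: "Vector_Spaces.linear scale3 s' h" and h': "Vector_Spaces.linear scale3 s' h'"
    and eq: "\<And>x y z. h (pure3 s x y z) = h' (pure3 s x y z)" and t: "t \<in> tensor3_space s"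
  shows "h t = h' t"
proof -
  interpret vector_space_pair "scale3 :: 'k \<Rightarrow> ('a, 'k) tensor3 \<Rightarrow> _" s'
    using h by (simp add: Vector_Spaces.linear_def vector_space_pair_def)
  show "h t = h' t"
    by (rule linear_eq_on[OF h h' t[unfolded tensor3_space_def]]) (auto simp: eq)
qed


section \<open>Multiplications\<close>

definition Lmul :: "('a \<Rightarrow> 'a \<Rightarrow> 'a) \<Rightarrow> 'a \<Rightarrow> 'a \<Rightarrow> 'a" where
  "Lmul m x = (\<lambda>y. m x y)"

definition Rmul :: "('a \<Rightarrow> 'a \<Rightarrow> 'a) \<Rightarrow> 'a \<Rightarrow> 'a \<Rightarrow> 'a" where
  "Rmul m x = (\<lambda>y. m y x)"

definition bilinear_mult ::
  "('k::field \<Rightarrow> 'a::ab_group_add \<Rightarrow> 'a) \<Rightarrow> ('a \<Rightarrow> 'a \<Rightarrow> 'a) \<Rightarrow> bool" where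
  "bilinear_mult s m \<longleftrightarrow>
     (\<forall>x. Vector_Spaces.linear s s (Lmul m x)) \<and> (\<forall>x. Vector_Spaces.linear s s (Rmul m x))"


section \<open>Averaging Lie bialgebras\<close>

definition lie_algebra ::
  "('k::field \<Rightarrow> 'a::ab_group_add \<Rightarrow> 'a) \<Rightarrow> ('a \<Rightarrow> 'a \<Rightarrow> 'a) \<Rightarrow> bool" where
  "lie_algebra s br \<longleftrightarrow>
     bilinear_mult s br \<and> (\<forall>x. br x x = 0) \<and>
     (\<forall>x y z. br x (br y z) + br y (br z x) + br z (br x y) = 0)"

definition lie_coalgebra ::
  "('k::field \<Rightarrow> 'a::ab_group_add \<Rightarrow> 'a) \<Rightarrow> ('a \<Rightarrow> ('a, 'k) tensor2) \<Rightarrow> bool" where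
  "lie_coalgebra s \<delta> \<longleftrightarrow>
     linear_coproduct s \<delta> \<and> (\<forall>x. \<delta> x = - tau (\<delta> x)) \<and>
     (\<forall>x. (id + sigma + (sigma \<circ> sigma)) (id_tensor \<delta> (\<delta> x)) = 0)"

definition lie_bialgebra ::
  "('k::field \<Rightarrow> 'a::ab_group_add \<Rightarrow> 'a) \<Rightarrow> ('a \<Rightarrow> 'a \<Rightarrow> 'a) \<Rightarrow> ('a \<Rightarrow> ('a, 'k) tensor2) \<Rightarrow> bool"
where
  "lie_bialgebra s br \<delta> \<longleftrightarrow>
     lie_algebra s br \<and> lie_coalgebra s \<delta> \<and>
     (\<forall>x y. \<delta> (br x y) =
        (tmap s (Lmul br x) id + tmap s id (Lmul br x)) (\<delta> y)
      - (tmap s (Lmul br y) id + tmap s id (Lmul br y)) (\<delta> x))"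

definition averaging_lie_bialgebra ::
  "('k::field \<Rightarrow> 'a::ab_group_add \<Rightarrow> 'a) \<Rightarrow> ('a \<Rightarrow> 'a \<Rightarrow> 'a) \<Rightarrow> ('a \<Rightarrow> ('a, 'k) tensor2)
    \<Rightarrow> ('a \<Rightarrow> 'a) \<Rightarrow> ('a \<Rightarrow> 'a) \<Rightarrow> bool"
where
  "averaging_lie_bialgebra s br \<delta> P Q \<longleftrightarrow>
     lie_bialgebra s br \<delta> \<and> Vector_Spaces.linear s s P \<and> Vector_Spaces.linear s s Q \<and>
     (\<forall>x y. br (P x) (P y) = P (br (P x) y)) \<and>
     (\<forall>x y. br (P x) (Q y) = Q (br (P x) y) \<and> Q (br (P x) y) = Q (br x (Q y))) \<and>
     (\<forall>x. tmap s Q Q (\<delta> x) = tmap s Q id (\<delta> (Q x))) \<and>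
     (\<forall>x. tmap s Q P (\<delta> x) = tmap s Q id (\<delta> (P x)) \<and>
          tmap s Q id (\<delta> (P x)) = tmap s id P (\<delta> (P x)))"


section \<open>Special type-a pre-Leibniz bialgebras\<close>

definition leibniz_algebra ::
  "('k::field \<Rightarrow> 'a::ab_group_add \<Rightarrow> 'a) \<Rightarrow> ('a \<Rightarrow> 'a \<Rightarrow> 'a) \<Rightarrow> bool" where
  "leibniz_algebra s m \<longleftrightarrow>
     bilinear_mult s m \<and> (\<forall>x y z. m x (m y z) = m (m x y) z + m y (m x z))"

text \<open>
  The type is the matrix \<open>a\<close> with rows \<open>(1, -1)\<close> and \<open>(-1, 0)\<close>; \<open>succ + prec\<close> is the pointwise
  sum of the two multiplications.
\<close>

definition special_pre_leibniz_algebra ::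
  "('k::field \<Rightarrow> 'a::ab_group_add \<Rightarrow> 'a) \<Rightarrow> ('a \<Rightarrow> 'a \<Rightarrow> 'a) \<Rightarrow> ('a \<Rightarrow> 'a \<Rightarrow> 'a) \<Rightarrow> bool" where
  "special_pre_leibniz_algebra s succ prec \<longleftrightarrow>
     bilinear_mult s succ \<and> bilinear_mult s prec \<and>
     (\<forall>x y. prec x y = - prec y x) \<and>
     (let circ = succ + prec in
        leibniz_algebra s circ \<and>
        (\<forall>x y z. circ x (prec y z) = prec (circ x y) z + prec y (circ x z) \<and>
                 prec (circ x y) z + prec y (circ x z) = prec x (prec y z)))"

definition special_pre_leibniz_coalgebra ::
  "('k::field \<Rightarrow> 'a::ab_group_add \<Rightarrow> 'a) \<Rightarrow> ('a \<Rightarrow> ('a, 'k) tensor2) \<Rightarrow> ('a \<Rightarrow> ('a, 'k) tensor2)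
    \<Rightarrow> bool"
where
  "special_pre_leibniz_coalgebra s vartheta theta \<longleftrightarrow>
     linear_coproduct s vartheta \<and> linear_coproduct s theta \<and>
     (let \<eta> = vartheta + theta in
        \<forall>x. tensor_id \<eta> (\<eta> x) + tau_id (id_tensor \<eta> (\<eta> x)) - id_tensor \<eta> (\<eta> x) = 0 \<and>
            theta x = - tau (theta x) \<and>
            id_tensor theta (\<eta> x) = tensor_id \<eta> (theta x) + tau_id (id_tensor \<eta> (theta x)) \<and>
            id_tensor theta (vartheta x) = 0)"

definition special_pre_leibniz_bialgebra ::
  "('k::field \<Rightarrow> 'a::ab_group_add \<Rightarrow> 'a) \<Rightarrow> ('a \<Rightarrow> 'a \<Rightarrow> 'a) \<Rightarrow> ('a \<Rightarrow> 'a \<Rightarrow> 'a)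
    \<Rightarrow> ('a \<Rightarrow> ('a, 'k) tensor2) \<Rightarrow> ('a \<Rightarrow> ('a, 'k) tensor2) \<Rightarrow> bool"
where
  "special_pre_leibniz_bialgebra s succ prec vartheta theta \<longleftrightarrow>
     special_pre_leibniz_algebra s succ prec \<and> special_pre_leibniz_coalgebra s vartheta theta \<and>
     (let circ = succ + prec; \<eta> = vartheta + theta in
        \<forall>x y.
          \<eta> (prec x y) =
              (tmap s id id - tau) (tmap s id (Lmul prec x) (\<eta> y))
            + (tmap s id id - tau) (tmap s id (Rmul prec y) (\<eta> x)) \<and>
          tmap s (Lmul circ x) id (\<eta> y) =
              tmap s (Lmul prec x) id (\<eta> y)
            + tmap s id (Rmul circ y) (\<eta> x) - tmap s id (Rmul circ y) (theta x) \<and>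
          theta (circ x y) =
              (tmap s id (Lmul circ x) + tmap s (Lmul circ x) id) (theta y)
            - (tmap s id (Lmul circ y) + tmap s (Lmul circ y) id) (theta x) \<and>
          \<eta> (circ x y) =
              tmap s id (Rmul circ y) (\<eta> x)
            + (tmap s id (Lmul circ x) + tmap s (Lmul prec x) id) (\<eta> y)
            - tmap s (Lmul prec y) id (theta x))"

end

theory Submission
  imports Defs
begin

text \<open>
  Evaluating tensors on linear forms turns the cobracket into a Lie bracket
  \<open>{\<phi>, \<psi>} = (\<lambda>x. \<delta> x \<phi> \<psi>)\<close> on the dual space, for which the transposes of \<open>Q\<close> and \<open>P\<close> play
  the roles of \<open>P\<close> and \<open>Q\<close>. The coproducts \<open>\<eta>\<close> and \<open>\<theta>\<close> are then the transposes of the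
  products \<open>\<phi> \<circ> \<psi> = {\<phi> Q, \<psi>}\<close> and \<open>\<phi> \<prec> \<psi> = {\<phi>, \<psi>} P\<close>, so the coalgebra axioms are
  the algebra axioms for the dual. The compatibility conditions follow from the cocycle condition
  at \<open>[x, y]\<close>, \<open>[P x, P y]\<close> and \<open>[P x, y]\<close> by moving \<open>P\<close> and \<open>Q\<close> through brackets and cobrackets.
\<close>

section \<open>Tensors at arguments outside the dual space, and closure of the tensor square\<close>

lemma tensor2_space_induct [consumes 1, case_names zero pure add scale]:
  fixes s :: "'k::field \<Rightarrow> 'a::ab_group_add \<Rightarrow> 'a"
  assumes "t \<in> tensor2_space s" "R 0" "\<And>x y. R (pure2 s x y)"
    "\<And>t u. R t \<Longrightarrow> R u \<Longrightarrow> R (t + u)" "\<And>c t. R t \<Longrightarrow> R (scale2 c t)"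
  shows "R t"
proof -
  interpret vector_space "scale2 :: 'k \<Rightarrow> ('a, 'k) tensor2 \<Rightarrow> _"
    by (rule vector_space_scale2)
  have "subspace {t. R t}"
    using assms by (auto simp: subspace_def)
  then show ?thesis
    using span_induct[of t "{pure2 s x y |x y. True}" R] assms
    unfolding tensor2_space_def by blast
qed

lemma tensor2_outside_dual:
  assumes "t \<in> tensor2_space s" "\<phi> \<notin> dual_space s \<or> \<psi> \<notin> dual_space s"
  shows "t \<phi> \<psi> = 0"
  using assms by (induction rule: tensor2_space_induct) (auto simp: pure2_def scale2_def)

lemma linear_neg:
  assumes "Vector_Spaces.linear s1 s2 f"
  shows "f (- x) = - f x"
proof -
  interpret Vector_Spaces.linear s1 s2 f by fact
  show ?thesis by (rule neg)
qed

lemma dual_space_uminus: "\<phi> \<in> dual_space s \<Longrightarrow> (\<lambda>x. - \<phi> x) \<in> dual_space s"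
  by (auto simp: dual_space_def Vector_Spaces.linear_iff)

text \<open>Serves nested coproducts at a non-linear argument: the inner form is then constantly
  zero, and the outer tensor has to vanish on it.\<close>

lemma tensor2_zero:
  assumes "t \<in> tensor2_space s"
  shows "t \<phi> (\<lambda>x. 0) = 0" "t (\<lambda>x. 0) \<phi> = 0"
  using assms by (induction rule: tensor2_space_induct) (auto simp: pure2_def scale2_def)

text \<open>Oddness in the second slot, which lets an antisymmetry be applied inside a nested
  bracket. If \<open>\<phi>\<close> is not linear, both sides are 0 by the default value.\<close>

lemma tensor2_uminus:
  assumes "t \<in> tensor2_space s" "\<psi> \<in> dual_space s"
  shows "t \<phi> (\<lambda>x. - \<psi> x) = - t \<phi> \<psi>"
  using assms
  by (induction rule: tensor2_space_induct) (auto simp: pure2_def scale2_def dual_space_uminus)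

lemma tensor2_eqI:
  assumes "\<And>\<phi> \<psi>. \<phi> \<in> dual_space s \<Longrightarrow> \<psi> \<in> dual_space s \<Longrightarrow> t \<phi> \<psi> = u \<phi> \<psi>"
    and "\<And>\<phi> \<psi>. \<phi> \<notin> dual_space s \<or> \<psi> \<notin> dual_space s \<Longrightarrow> t \<phi> \<psi> = u \<phi> \<psi>"
  shows "t = u"
  using assms by (auto simp: fun_eq_iff)

lemma tmap_apply:
  "\<phi> \<in> dual_space s \<Longrightarrow> \<psi> \<in> dual_space s \<Longrightarrow> tmap s f g t \<phi> \<psi> = t (\<phi> \<circ> f) (\<psi> \<circ> g)"
  by (simp add: tmap_def)

lemma tmap_outside_dual:
  "\<phi> \<notin> dual_space s \<or> \<psi> \<notin> dual_space s \<Longrightarrow> tmap s f g t \<phi> \<psi> = 0"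
  by (auto simp: tmap_def)

text \<open>A non-linear \<open>\<phi>\<close> kills the outer tensor. Otherwise
  \<open>\<psi>\<close> or \<open>\<chi>\<close> is non-linear, every inner value
  \<open>D y \<psi> \<chi>\<close> is 0, and the outer tensor is evaluated at the zero form.\<close>

lemma id_tensor_outside_dual:
  assumes "\<And>y. D y \<in> tensor2_space s" "t \<in> tensor2_space s"
    and "\<not> (\<phi> \<in> dual_space s \<and> \<psi> \<in> dual_space s \<and> \<chi> \<in> dual_space s)"
  shows "id_tensor D t \<phi> \<psi> \<chi> = 0"
proof (cases "\<phi> \<in> dual_space s")
  case True
  then have "(\<lambda>y. D y \<psi> \<chi>) = (\<lambda>y. 0)"
    using assms tensor2_outside_dual by blast
  then show ?thesis
    by (simp add: id_tensor_def tensor2_zero[OF assms(2)])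
qed (simp add: id_tensor_def tensor2_outside_dual[OF assms(2)])

lemma tensor_id_outside_dual:
  assumes "\<And>y. D y \<in> tensor2_space s" "t \<in> tensor2_space s"
    and "\<not> (\<phi> \<in> dual_space s \<and> \<psi> \<in> dual_space s \<and> \<chi> \<in> dual_space s)"
  shows "tensor_id D t \<phi> \<psi> \<chi> = 0"
proof (cases "\<chi> \<in> dual_space s")
  case True
  then have "(\<lambda>y. D y \<phi> \<psi>) = (\<lambda>y. 0)"
    using assms tensor2_outside_dual by blast
  then show ?thesis
    by (simp add: tensor_id_def tensor2_zero[OF assms(2)])
qed (simp add: tensor_id_def tensor2_outside_dual[OF assms(2)])

lemma tmap_in_tensor2_space:
  fixes s :: "'k::field \<Rightarrow> 'a::ab_group_add \<Rightarrow> 'a"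
  assumes "t \<in> tensor2_space s" "Vector_Spaces.linear s s f" "Vector_Spaces.linear s s g"
  shows "tmap s f g t \<in> tensor2_space s"
proof -
  interpret T: vector_space "scale2 :: 'k \<Rightarrow> ('a, 'k) tensor2 \<Rightarrow> _"
    by (rule vector_space_scale2)
  interpret M: Vector_Spaces.linear "scale2 :: 'k \<Rightarrow> ('a, 'k) tensor2 \<Rightarrow> _" scale2 "tmap s f g"
    by (rule tensor_maps_linear)
  show ?thesis
    using assms(1)
  proof (induction rule: tensor2_space_induct)
    case (pure x y)
    then show ?case
      unfolding tmap_pure2[OF assms(2,3)] tensor2_space_def by (auto intro!: T.span_base)
  next
    case (add t u)
    then show ?case
      unfolding tensor2_space_def M.add by (rule T.span_add)
  next
    case (scale c t)
    then show ?case
      unfolding tensor2_space_def M.scale by (rule T.span_scale)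
  qed (simp only: M.zero tensor2_space_def T.span_zero)
qed

lemma linear_coproduct_diff:
  fixes s :: "'k::field \<Rightarrow> 'a::ab_group_add \<Rightarrow> 'a"
  assumes "linear_coproduct s D" "linear_coproduct s E"
  shows "linear_coproduct s (\<lambda>x. D x - E x)"
proof -
  interpret T: vector_space "scale2 :: 'k \<Rightarrow> ('a, 'k) tensor2 \<Rightarrow> _"
    by (rule vector_space_scale2)
  show ?thesis
    using assms
    by (auto simp: linear_coproduct_def Vector_Spaces.linear_iff tensor2_space_def
        T.span_diff T.scale_right_diff_distrib)
qed

lemma linear_coproduct_comp:
  assumes "linear_coproduct s D" "Vector_Spaces.linear s s f"
  shows "linear_coproduct s (\<lambda>x. D (f x))"
  using assms by (auto simp: linear_coproduct_def Vector_Spaces.linear_iff)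

lemma linear_coproduct_tmap:
  assumes "linear_coproduct s D" "Vector_Spaces.linear s s f" "Vector_Spaces.linear s s g"
  shows "linear_coproduct s (\<lambda>x. tmap s f g (D x))"
  using assms Vector_Spaces.linear_compose[OF _ tensor_maps_linear(1), of s D s f g]
  by (auto simp: linear_coproduct_def o_def intro: tmap_in_tensor2_space)

lemma dual_coproduct_of:
  "linear_coproduct s D \<Longrightarrow> (\<lambda>y. D y \<psi> \<chi>) \<in> dual_space s"
  by (simp add: linear_coproduct_def dual_coproduct)

locale averaging_lie_bialg =
  fixes s :: "'k::field \<Rightarrow> 'a::ab_group_add \<Rightarrow> 'a"
    and br :: "'a \<Rightarrow> 'a \<Rightarrow> 'a"
    and \<delta> :: "'a \<Rightarrow> ('a, 'k) tensor2"
    and P Q :: "'a \<Rightarrow> 'a"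
  assumes averaging: "averaging_lie_bialgebra s br \<delta> P Q"
begin

abbreviation (input) ad :: "'a \<Rightarrow> 'a \<Rightarrow> 'a" where "ad \<equiv> Lmul br"

section \<open>Bracket identities and the algebra axioms\<close>

lemma linear_P: "Vector_Spaces.linear s s P"
  and linear_Q: "Vector_Spaces.linear s s Q"
  and br_PP: "br (P x) (P y) = P (br (P x) y)"
  and br_PQ: "br (P x) (Q y) = Q (br (P x) y)"
  and Q_br_Q: "Q (br (P x) y) = Q (br x (Q y))"
  and tmap_QQ: "tmap s Q Q (\<delta> x) = tmap s Q id (\<delta> (Q x))"
  and tmap_QP: "tmap s Q P (\<delta> x) = tmap s Q id (\<delta> (P x))"
  and tmap_idP: "tmap s Q id (\<delta> (P x)) = tmap s id P (\<delta> (P x))"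
  and coproduct: "linear_coproduct s \<delta>"
  and \<delta>_tau: "\<delta> x = - tau (\<delta> x)"
  and coJacobi: "(id + sigma + (sigma \<circ> sigma)) (id_tensor \<delta> (\<delta> x)) = 0"
  and cocycle: "\<delta> (br x y) =
        (tmap s (ad x) id + tmap s id (ad x)) (\<delta> y)
      - (tmap s (ad y) id + tmap s id (ad y)) (\<delta> x)"
  and bilinear: "bilinear_mult s br"
  and br_self: "br x x = 0"
  and Jacobi: "br x (br y z) + br y (br z x) + br z (br x y) = 0"
  using averaging
  unfolding averaging_lie_bialgebra_def lie_bialgebra_def lie_algebra_def lie_coalgebra_def
  by blast+

lemma linear_ad: "Vector_Spaces.linear s s (ad x)"
  and linear_Rmul: "Vector_Spaces.linear s s (Rmul br x)"
  using bilinear by (auto simp: bilinear_mult_def)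

lemma vs: "vector_space s"
  using linear_P by (simp add: Vector_Spaces.linear_iff)

lemma P_add: "P (x + y) = P x + P y" and P_scale: "P (s c x) = s c (P x)"
  and Q_add: "Q (x + y) = Q x + Q y" and Q_scale: "Q (s c x) = s c (Q x)"
  using linear_P linear_Q by (auto simp: Vector_Spaces.linear_iff)

lemma br_add: "br (x + y) z = br x z + br y z" "br x (y + z) = br x y + br x z"
  and br_scale: "br (s c x) z = s c (br x z)" "br x (s c z) = s c (br x z)"
  using linear_ad[of x] linear_Rmul[of z]
  by (auto simp: Vector_Spaces.linear_iff Lmul_def Rmul_def)

lemma br_anti: "br x y = - br y x"
proof -
  have "br (x + y) (x + y) = 0" by (rule br_self)
  then have "br x y + br y x = 0"
    unfolding br_add by (simp add: br_self add.commute)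
  then show ?thesis by (metis eq_neg_iff_add_eq_0)
qed

lemma br_minus: "br x (- y) = - br x y"
  using linear_neg[OF linear_ad] by (simp add: Lmul_def)

lemma Q_minus: "Q (- x) = - Q x"
  by (rule linear_neg[OF linear_Q])

text \<open>The Jacobi identity with two brackets reversed, so that left multiplication acts as a
  derivation.\<close>

lemma br_Leibniz: "br x (br y z) = br (br x y) z + br y (br x z)"
proof -
  have "br x (br y z) - br y (br x z) - br (br x y) z = 0"
    using Jacobi[of x y z] br_anti[of z x] br_anti[of z "br x y"] by (simp add: br_minus)
  then show ?thesis by (simp add: algebra_simps)
qed

text \<open>The sum of the two products is \<open>br (P x) y\<close>. Its Leibniz identity and the
  derivation rule over the second product are \<open>br_Leibniz\<close> at \<open>P x\<close>, once
  \<open>P\<close> or \<open>Q\<close> has been moved through the bracket.\<close>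

lemma special_algebra:
  "special_pre_leibniz_algebra s (\<lambda>x y. br (P x) y - Q (br x y)) (\<lambda>x y. Q (br x y))"
proof -
  have circ: "(\<lambda>x y. br (P x) y - Q (br x y)) + (\<lambda>x y. Q (br x y)) = (\<lambda>x y. br (P x) y)"
    by (auto simp: fun_eq_iff)
  interpret vector_space s by (rule vs)
  have bil: "bilinear_mult s (\<lambda>x y. br (P x) y - Q (br x y))"
    "bilinear_mult s (\<lambda>x y. Q (br x y))" "bilinear_mult s (\<lambda>x y. br (P x) y)"
    by (auto simp: bilinear_mult_def Lmul_def Rmul_def br_add br_scale P_add P_scale Q_add Q_scale
        algebra_simps intro!: linearI vs)
  have "Q (br x y) = - Q (br y x)" for x y
    using br_anti[of x y] by (simp add: Q_minus)
  moreover have "br (P x) (br (P y) z) = br (P (br (P x) y)) z + br (P y) (br (P x) z)" for x y z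
    using br_Leibniz[of "P x" "P y" z] by (simp add: br_PP)
  moreover have "br (P x) (Q (br y z)) = Q (br (br (P x) y) z) + Q (br y (br (P x) z))" for x y z
    using br_Leibniz[of "P x" y z] by (simp add: br_PQ Q_add)
  \<comment> \<open>Both sides are \<open>Q (br (P x) (br y z))\<close>: the left by
    \<open>br_PQ\<close>, the right by \<open>Q_br_Q\<close>.\<close>
  moreover have "br (P x) (Q (br y z)) = Q (br x (Q (br y z)))" for x y z
    by (simp add: br_PQ flip: Q_br_Q)
  ultimately show ?thesis
    unfolding special_pre_leibniz_algebra_def circ Let_def leibniz_algebra_def
    using bil by metis
qed

section \<open>The Lie bracket on the dual space\<close>

lemma in_tensor2: "\<delta> x \<in> tensor2_space s"
  using coproduct by (simp add: linear_coproduct_def)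

lemma dual_bracket: "(\<lambda>y. \<delta> y \<psi> \<chi>) \<in> dual_space s"
  by (rule dual_coproduct_of[OF coproduct])

lemma \<delta>_anti: "\<delta> x \<phi> \<psi> = - \<delta> x \<psi> \<phi>"
  by (subst \<delta>_tau) (simp add: tau_def)

lemmas comp_dual = dual_comp[OF linear_P] dual_comp[OF linear_Q] dual_comp[OF linear_ad]
  dual_comp[OF linear_Rmul]

text \<open>In the dual bracket: \<open>{\<phi> Q, \<psi>} Q = {\<phi> Q, \<psi> Q}\<close>, the
  averaging identity for the transpose of \<open>Q\<close>.\<close>

lemma \<delta>_Q:
  assumes "\<phi> \<in> dual_space s" "\<psi> \<in> dual_space s"
  shows "\<delta> (Q x) (\<phi> \<circ> Q) \<psi> = \<delta> x (\<phi> \<circ> Q) (\<psi> \<circ> Q)"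
  using fun_cong[OF fun_cong[OF tmap_QQ[of x]], of \<phi> \<psi>] assms by (simp add: tmap_apply)

text \<open>In the dual bracket: \<open>{\<phi> Q, \<psi> P} = {\<phi> Q, \<psi>} P = {\<phi>,
  \<psi> P} P\<close>. Both rules rewrite to the middle term, and this common normal form is what
  makes terms cancel later.\<close>

lemma \<delta>_P:
  assumes "\<phi> \<in> dual_space s" "\<psi> \<in> dual_space s"
  shows "\<delta> x (\<phi> \<circ> Q) (\<psi> \<circ> P) = \<delta> (P x) (\<phi> \<circ> Q) \<psi>"
    and "\<delta> (P x) \<phi> (\<psi> \<circ> P) = \<delta> (P x) (\<phi> \<circ> Q) \<psi>"
  using fun_cong[OF fun_cong[OF tmap_QP[of x]], of \<phi> \<psi>]
    fun_cong[OF fun_cong[OF tmap_idP[of x]], of \<phi> \<psi>] assms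
  by (simp_all add: tmap_apply)

lemma \<delta>_br:
  assumes "\<phi> \<in> dual_space s" "\<psi> \<in> dual_space s"
  shows "\<delta> (br x y) \<phi> \<psi> = \<delta> y (\<phi> \<circ> ad x) \<psi> + \<delta> y \<phi> (\<psi> \<circ> ad x)
    - \<delta> x (\<phi> \<circ> ad y) \<psi> - \<delta> x \<phi> (\<psi> \<circ> ad y)"
  using assms by (subst cocycle) (simp add: tmap_apply)

text \<open>The three cyclic terms of co-Jacobi are the Jacobi identity of the dual bracket;
  reversing two brackets gives the derivation form, parallel to \<open>br_Leibniz\<close>.\<close>

lemma \<delta>_Leibniz:
  "\<delta> x \<phi> (\<lambda>y. \<delta> y \<psi> \<chi>) = \<delta> x (\<lambda>y. \<delta> y \<phi> \<psi>) \<chi> + \<delta> x \<psi> (\<lambda>y. \<delta> y \<phi> \<chi>)"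
proof -
  have "\<delta> x \<phi> (\<lambda>y. \<delta> y \<psi> \<chi>) + \<delta> x \<psi> (\<lambda>y. \<delta> y \<chi> \<phi>) + \<delta> x \<chi> (\<lambda>y. \<delta> y \<phi> \<psi>) = 0"
    using fun_cong[OF fun_cong[OF fun_cong[OF coJacobi[of x]]], of \<phi> \<psi> \<chi>]
    by (simp add: sigma_def id_tensor_def)
  moreover have "\<delta> x \<psi> (\<lambda>y. \<delta> y \<chi> \<phi>) = - \<delta> x \<psi> (\<lambda>y. \<delta> y \<phi> \<chi>)"
    using tensor2_uminus[OF in_tensor2 dual_bracket, of x \<psi> \<phi> \<chi>]
    by (subst \<delta>_anti[of _ \<chi> \<phi>])
  moreover have "\<delta> x \<chi> (\<lambda>y. \<delta> y \<phi> \<psi>) = - \<delta> x (\<lambda>y. \<delta> y \<phi> \<psi>) \<chi>"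
    by (rule \<delta>_anti)
  ultimately show ?thesis by (simp add: algebra_simps)
qed

text \<open>The cocycle condition is phrased with left multiplications. Right multiplication is
  their negative, and the tensor is odd in this slot.\<close>

lemma \<delta>_Rmul:
  assumes "\<psi> \<in> dual_space s"
  shows "\<delta> x \<phi> (\<psi> \<circ> Rmul br y) = - \<delta> x \<phi> (\<psi> \<circ> ad y)"
proof -
  have "\<psi> (- z) = - \<psi> z" for z
    using linear_neg assms by (auto simp: dual_space_def)
  then have "\<psi> \<circ> Rmul br y = (\<lambda>z. - (\<psi> \<circ> ad y) z)"
    using br_anti[of _ y] by (auto simp: fun_eq_iff Rmul_def Lmul_def)
  then show ?thesis
    using tensor2_uminus[OF in_tensor2 comp_dual(3)[OF assms]] by simp
qed

lemma eta_sum: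
  "(\<lambda>x. tmap s Q id (\<delta> x) - \<delta> (P x)) + (\<lambda>x. \<delta> (P x)) = (\<lambda>x. tmap s Q id (\<delta> x))"
  by (auto simp: fun_eq_iff)

lemma linear_id: "Vector_Spaces.linear s s id"
  by (rule linearI[OF vs vs]) simp_all

lemma coproduct_eta: "linear_coproduct s (\<lambda>x. tmap s Q id (\<delta> x))"
  by (rule linear_coproduct_tmap[OF coproduct linear_Q linear_id])

lemma coproduct_theta: "linear_coproduct s (\<lambda>x. \<delta> (P x))"
  by (rule linear_coproduct_comp[OF coproduct linear_P])

lemma eta_apply:
  "\<phi> \<in> dual_space s \<Longrightarrow> \<psi> \<in> dual_space s \<Longrightarrow> tmap s Q id (\<delta> x) \<phi> \<psi> = \<delta> x (\<phi> \<circ> Q) \<psi>"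
  by (simp add: tmap_apply)

lemma dual_bracket_P: "(\<lambda>y. \<delta> (P y) \<psi> \<chi>) = (\<lambda>y. \<delta> y \<psi> \<chi>) \<circ> P"
  by (simp add: o_def)

text \<open>On linear forms the first axiom is \<open>\<delta>_Leibniz\<close> at
  \<open>\<phi> \<circ> Q\<close>, \<open>\<psi> \<circ> Q\<close>, \<open>\<chi>\<close>, and the
  third is \<open>\<delta>_Leibniz\<close> at \<open>P x\<close> and
  \<open>\<phi> \<circ> Q\<close>, \<open>\<psi>\<close>, \<open>\<chi>\<close>; off the linear
  forms every term is 0.\<close>

lemma special_coalgebra:
  "special_pre_leibniz_coalgebra s (\<lambda>x. tmap s Q id (\<delta> x) - \<delta> (P x)) (\<lambda>x. \<delta> (P x))"
proof -
  let ?eta = "\<lambda>x. tmap s Q id (\<delta> x)" and ?theta = "\<lambda>x. \<delta> (P x)"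
  let ?vtheta = "\<lambda>x. tmap s Q id (\<delta> x) - \<delta> (P x)"
  have cv: "linear_coproduct s ?vtheta"
    by (rule linear_coproduct_diff[OF coproduct_eta coproduct_theta])
  have mem: "?eta x \<in> tensor2_space s" "?theta x \<in> tensor2_space s" "?vtheta x \<in> tensor2_space s"
    for x
    using cv coproduct_eta coproduct_theta by (auto simp: linear_coproduct_def)
  note outside = id_tensor_outside_dual[OF mem(1) mem(1)] id_tensor_outside_dual[OF mem(2) mem(1)]
    id_tensor_outside_dual[OF mem(1) mem(2)] id_tensor_outside_dual[OF mem(2) mem(3)]
    tensor_id_outside_dual[OF mem(1) mem(1)] tensor_id_outside_dual[OF mem(1) mem(2)]
  \<comment> \<open>In \<open>tensor_id ?eta (?eta x)\<close> the inner bracket lands in the first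
    slot of the outer one and is composed with \<open>Q\<close> there.\<close>
  have Q_bracket: "(\<lambda>y. \<delta> y (\<phi> \<circ> Q) \<psi>) \<circ> Q = (\<lambda>y. \<delta> y (\<phi> \<circ> Q) (\<psi> \<circ> Q))"
    if "\<phi> \<in> dual_space s" "\<psi> \<in> dual_space s" for \<phi> \<psi>
    using \<delta>_Q[OF that] by (auto simp: fun_eq_iff)
  have 1: "tensor_id ?eta (?eta x) + tau_id (id_tensor ?eta (?eta x)) - id_tensor ?eta (?eta x) = 0"
    (is "?t = 0") for x
  proof (intro ext)
    fix \<phi> \<psi> \<chi>
    show "?t \<phi> \<psi> \<chi> = (0 :: ('a, 'k) tensor3) \<phi> \<psi> \<chi>"
    proof (cases "\<phi> \<in> dual_space s \<and> \<psi> \<in> dual_space s \<and> \<chi> \<in> dual_space s")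
      case True
      then show ?thesis
        using \<delta>_Leibniz[of x "\<phi> \<circ> Q" "\<psi> \<circ> Q" \<chi>]
        by (simp add: tensor_id_def tau_id_def id_tensor_def eta_apply dual_bracket Q_bracket)
    next
      case False
      \<comment> \<open>\<open>tau_id\<close> swaps the first two forms, so the vanishing rules also
        need their premise in the swapped order; keeping the negated conjunction intact lets it
        match.\<close>
      then have "\<not> (\<psi> \<in> dual_space s \<and> \<phi> \<in> dual_space s \<and> \<chi> \<in> dual_space s)"
        by blast
      with False show ?thesis by (simp add: tau_id_def outside del: de_Morgan_conj)
    qed
  qed
  have 2: "id_tensor ?theta (?eta x) = tensor_id ?eta (?theta x) + tau_id (id_tensor ?eta (?theta x))"
    (is "?t = ?u") for x
  proof (intro ext)
    fix \<phi> \<psi> \<chi>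
    show "?t \<phi> \<psi> \<chi> = ?u \<phi> \<psi> \<chi>"
    proof (cases "\<phi> \<in> dual_space s \<and> \<psi> \<in> dual_space s \<and> \<chi> \<in> dual_space s")
      case True
      then show ?thesis
        using \<delta>_Leibniz[of "P x" "\<phi> \<circ> Q" \<psi> \<chi>]
        by (simp add: tensor_id_def tau_id_def id_tensor_def eta_apply dual_bracket
            dual_bracket_P comp_dual \<delta>_P)
    next
      case False
      then have "\<not> (\<psi> \<in> dual_space s \<and> \<phi> \<in> dual_space s \<and> \<chi> \<in> dual_space s)"
        by blast
      with False show ?thesis by (simp add: tau_id_def outside del: de_Morgan_conj)
    qed
  qed
  have 3: "id_tensor ?theta (?vtheta x) = 0" (is "?t = 0") for x
  proof (intro ext)
    fix \<phi> \<psi> \<chi>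
    show "?t \<phi> \<psi> \<chi> = (0 :: ('a, 'k) tensor3) \<phi> \<psi> \<chi>"
    proof (cases "\<phi> \<in> dual_space s \<and> \<psi> \<in> dual_space s \<and> \<chi> \<in> dual_space s")
      case True
      then show ?thesis
        \<comment> \<open>Both summands of \<open>?vtheta\<close> contribute \<open>\<delta> (P x)
          (\<phi> \<circ> Q) (\<lambda>y. \<delta> y \<psi> \<chi>)\<close>, by the two equations of
          \<open>\<delta>_P\<close>, and cancel.\<close>
        by (simp add: id_tensor_def eta_apply dual_bracket dual_bracket_P comp_dual \<delta>_P)
    next
      case False
      then show ?thesis by (simp add: outside del: de_Morgan_conj)
    qed
  qed
  show ?thesis
    unfolding special_pre_leibniz_coalgebra_def eta_sum Let_def
    by (intro conjI allI cv coproduct_theta 1 2 3 \<delta>_tau)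
qed

section \<open>Compatibility of the products with the coproducts\<close>

lemma ad_P_Q: "ad (P x) \<circ> Q = Q \<circ> ad (P x)"
  by (auto simp: fun_eq_iff Lmul_def br_PQ)

lemma Q_ad_Q: "Q \<circ> (ad x \<circ> Q) = Q \<circ> ad (P x)"
  by (auto simp: fun_eq_iff Lmul_def Q_br_Q[symmetric])

text \<open>The multiplication operators of the two products appear as composites with
  \<open>P\<close> and \<open>Q\<close>, so that \<open>tmap_apply\<close> turns each identity into
  one about composed forms.\<close>

lemma compatibility:
  shows "tmap s Q id (\<delta> (Q (br x y))) =
      (tmap s id id - tau) (tmap s id (Q \<circ> ad x) (tmap s Q id (\<delta> y)))
    + (tmap s id id - tau) (tmap s id (Q \<circ> Rmul br y) (tmap s Q id (\<delta> x)))"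
    and "tmap s (ad (P x)) id (tmap s Q id (\<delta> y)) =
      tmap s (Q \<circ> ad x) id (tmap s Q id (\<delta> y))
    + tmap s id (Rmul br y \<circ> P) (tmap s Q id (\<delta> x)) - tmap s id (Rmul br y \<circ> P) (\<delta> (P x))"
    and "\<delta> (P (br (P x) y)) =
      (tmap s id (ad (P x)) + tmap s (ad (P x)) id) (\<delta> (P y))
    - (tmap s id (ad (P y)) + tmap s (ad (P y)) id) (\<delta> (P x))"
    and "tmap s Q id (\<delta> (br (P x) y)) =
      tmap s id (Rmul br y \<circ> P) (tmap s Q id (\<delta> x))
    + (tmap s id (ad (P x)) + tmap s (Q \<circ> ad x) id) (tmap s Q id (\<delta> y))
    - tmap s (Q \<circ> ad y) id (\<delta> (P x))"
proof -
  show "tmap s Q id (\<delta> (Q (br x y))) =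
      (tmap s id id - tau) (tmap s id (Q \<circ> ad x) (tmap s Q id (\<delta> y)))
    + (tmap s id id - tau) (tmap s id (Q \<circ> Rmul br y) (tmap s Q id (\<delta> x)))"
  proof (rule tensor2_eqI[where s = s])
    fix \<phi> \<psi> assume d: "\<phi> \<in> dual_space s" "\<psi> \<in> dual_space s"
    \<comment> \<open>The flip in \<open>id - tau\<close> exchanges the two forms. These instances
      restore the order in which the cocycle expansion of \<open>\<delta> (br x y)\<close> at
      \<open>\<phi> \<circ> Q\<close>, \<open>\<psi> \<circ> Q\<close> has them.\<close>
    note \<delta>_anti[of y "\<psi> \<circ> Q" "\<phi> \<circ> Q \<circ> ad x"] \<delta>_anti[of x "\<psi> \<circ> Q" "\<phi> \<circ> Q \<circ> ad y"]
    then show "tmap s Q id (\<delta> (Q (br x y))) \<phi> \<psi> =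
      ((tmap s id id - tau) (tmap s id (Q \<circ> ad x) (tmap s Q id (\<delta> y)))
    + (tmap s id id - tau) (tmap s id (Q \<circ> Rmul br y) (tmap s Q id (\<delta> x)))) \<phi> \<psi>"
      using d by (simp add: tmap_apply tau_def comp_dual o_assoc \<delta>_Q \<delta>_br \<delta>_Rmul)
  qed (auto simp: tmap_outside_dual tau_def)
  show "tmap s (ad (P x)) id (tmap s Q id (\<delta> y)) =
      tmap s (Q \<circ> ad x) id (tmap s Q id (\<delta> y))
    + tmap s id (Rmul br y \<circ> P) (tmap s Q id (\<delta> x)) - tmap s id (Rmul br y \<circ> P) (\<delta> (P x))"
    \<comment> \<open>By \<open>\<delta>_P\<close> the two \<open>Rmul\<close> terms are equal and
      cancel; what remains is \<open>Q \<circ> ad x \<circ> Q = ad (P x) \<circ> Q\<close>. The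
      first \<open>auto\<close> associates compositions to the left to expose
      \<open>\<delta>_P\<close>, the second to the right to expose the operator identities.\<close>
    by (rule tensor2_eqI[where s = s])
      (auto simp: tmap_apply tmap_outside_dual comp_dual o_assoc \<delta>_P,
        auto simp: comp_assoc Q_ad_Q ad_P_Q)
  show "\<delta> (P (br (P x) y)) =
      (tmap s id (ad (P x)) + tmap s (ad (P x)) id) (\<delta> (P y))
    - (tmap s id (ad (P y)) + tmap s (ad (P y)) id) (\<delta> (P x))"
    \<comment> \<open>Read backwards, \<open>br_PP\<close> turns the argument into
      \<open>br (P x) (P y)\<close>, where the cocycle condition applies.\<close>
    by (simp flip: br_PP add: cocycle algebra_simps)
  show "tmap s Q id (\<delta> (br (P x) y)) =
      tmap s id (Rmul br y \<circ> P) (tmap s Q id (\<delta> x))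
    + (tmap s id (ad (P x)) + tmap s (Q \<circ> ad x) id) (tmap s Q id (\<delta> y))
    - tmap s (Q \<circ> ad y) id (\<delta> (P x))"
  proof (rule tensor2_eqI[where s = s])
    fix \<phi> \<psi> assume d: "\<phi> \<in> dual_space s" "\<psi> \<in> dual_space s"
    \<comment> \<open>Matches the term from \<open>Q \<circ> ad x\<close> with the cocycle term in
      which \<open>ad (P x)\<close> acts on the first slot of \<open>\<delta> y\<close>.\<close>
    have *: "\<phi> \<circ> Q \<circ> ad x \<circ> Q = \<phi> \<circ> Q \<circ> ad (P x)"
      by (simp add: comp_assoc Q_ad_Q)
    show "tmap s Q id (\<delta> (br (P x) y)) \<phi> \<psi> =
      (tmap s id (Rmul br y \<circ> P) (tmap s Q id (\<delta> x))
    + (tmap s id (ad (P x)) + tmap s (Q \<circ> ad x) id) (tmap s Q id (\<delta> y))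
    - tmap s (Q \<circ> ad y) id (\<delta> (P x))) \<phi> \<psi>"
      using d by (simp add: tmap_apply comp_dual o_assoc \<delta>_P \<delta>_br \<delta>_Rmul *)
  qed (auto simp: tmap_outside_dual)
qed

lemma special_bialgebra:
  "special_pre_leibniz_bialgebra s
     (\<lambda>x y. br (P x) y - Q (br x y)) (\<lambda>x y. Q (br x y))
     (\<lambda>x. tmap s Q id (\<delta> x) - \<delta> (P x)) (\<lambda>x. \<delta> (P x))"
proof -
  have circ: "(\<lambda>x y. br (P x) y - Q (br x y)) + (\<lambda>x y. Q (br x y)) = (\<lambda>x y. br (P x) y)"
    by (auto simp: fun_eq_iff)
  have mults: "Lmul (\<lambda>x y. br (P x) y) x = ad (P x)" "Rmul (\<lambda>x y. br (P x) y) x = Rmul br x \<circ> P"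
    "Lmul (\<lambda>x y. Q (br x y)) x = Q \<circ> ad x" "Rmul (\<lambda>x y. Q (br x y)) x = Q \<circ> Rmul br x" for x
    by (auto simp: Lmul_def Rmul_def)
  show ?thesis
    unfolding special_pre_leibniz_bialgebra_def Let_def circ eta_sum mults
    by (intro conjI allI special_algebra special_coalgebra compatibility)
qed

end

theorem proposition4p12:
  fixes s :: "'k::{alg_closed_field, field_char_0} \<Rightarrow> 'a::ab_group_add \<Rightarrow> 'a"
    and br :: "'a \<Rightarrow> 'a \<Rightarrow> 'a"
    and \<delta> :: "'a \<Rightarrow> ('a, 'k) tensor2"
    and P Q :: "'a \<Rightarrow> 'a"
  assumes "\<exists>B. finite_dimensional_vector_space s B"
    and "averaging_lie_bialgebra s br \<delta> P Q"
  shows "special_pre_leibniz_bialgebra s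
           (\<lambda>x y. br (P x) y - Q (br x y))
           (\<lambda>x y. Q (br x y))
           (\<lambda>x. tmap s Q id (\<delta> x) - \<delta> (P x))
           (\<lambda>x. \<delta> (P x))"
proof -
  interpret averaging_lie_bialg s br \<delta> P Q
    using assms(2) by unfold_locales
  show ?thesis by (rule special_bialgebra)
qed

end
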